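(* Let $n \geq 4$. (i) Let $\Pi(V)$ and $\Pi(V')$ be faces of $h\gamma_n$, where each of $V$ and $V'$ is of one of the following forms: $\{\mathbf{v}\}$ with $\mathbf{v} \in \Psi^+_n$; $K(\mathbf{v}',S)$ with $\mathbf{v}' \in \Psi^-_n$, $S \subseteq \mathbf{n}$ and $2 \le |S| \le n$; or $L(\mathbf{v},S)$ with $\mathbf{v} \in \Psi^+_n$, $S \subset \mathbf{n}$ and $3 \leq |S| < n$. Then $\Pi(V) \cap \Pi(V') = \Pi(V \cap V')$. (ii) No point of $h\gamma_n$ can be an interior point of more than one face. (iii) Every point of $h\gamma_n$ is either an interior point of $h\gamma_n$, or a vertex of $h\gamma_n$, or is an interior point of a (unique) $k$-face of $h\gamma_n$ for some $0 < k < n$.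
   Context: Let $\mathbf{n} = \{1,2,\ldots,n\}$. $\Psi_n = \{\pm 1\}^n \subset \mathbb{R}^n$; $\Psi^+_n$ is the subset of points with an even number of negative coordinates, and $\Psi^-_n = \Psi_n \setminus \Psi^+_n$. For a finite set $V \subset \mathbb{R}^n$, $\Pi(V)$ denotes its convex hull (so $\Pi(\emptyset) = \emptyset$). The half cube is the polytope $h\gamma_n = \Pi(\Psi^+_n)$; its $k$-faces ($0 \le k \le n$) are its $k$-dimensional faces in the usual sense, with $h\gamma_n$ itself the $n$-face. "Interior point" of a face means a point of its relative interior (interior in its affine hull). For $\mathbf{v}' \in \Psi^-_n$ and nonempty $S \subseteq \mathbf{n}$, $K(\mathbf{v}',S)$ is the set of points of $\Psi^+_n$ that differ from $\mathbf{v}'$ in exactly one coordinate $i$, with $i \in S$. For $\mathbf{v} \in \Psi^+_n$ and $S \subseteq \mathbf{n}$, $L(\mathbf{v},S)$ is the set of points of $\Psi^+_n$ that agree with $\mathbf{v}$ in the $i$-th coordinate for every $i \notin S$. *)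

theory Defs
  imports "HOL-Analysis.Analysis"
begin

(* Coordinates are indexed by an arbitrary finite type 'n, which plays the role of {1,...,n}
   with n = CARD('n). *)

definition Psi :: "(real ^ 'n) set" where
  "Psi = {x. \<forall>i. x $ i = 1 \<or> x $ i = -1}"

definition Psi_even :: "(real ^ 'n) set" where
  "Psi_even = {x \<in> Psi. even (card {i. x $ i < 0})}"

definition Psi_odd :: "(real ^ 'n) set" where
  "Psi_odd = Psi - Psi_even"

definition half_cube :: "(real ^ 'n) set" where
  "half_cube = convex hull Psi_even"

definition K_set :: "real ^ 'n \<Rightarrow> 'n set \<Rightarrow> (real ^ 'n) set" where
  "K_set v' S = {w \<in> Psi_even. \<exists>i\<in>S. {j. w $ j \<noteq> v' $ j} = {i}}"

definition L_set :: "real ^ 'n \<Rightarrow> 'n set \<Rightarrow> (real ^ 'n) set" where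
  "L_set v S = {w \<in> Psi_even. \<forall>i. i \<notin> S \<longrightarrow> w $ i = v $ i}"

(* Since k is a natural number, the empty set (of affine dimension -1) is not a k-face,
   although it satisfies face_of. *)
definition k_face :: "nat \<Rightarrow> (real ^ 'n) set \<Rightarrow> bool" where
  "k_face k F \<longleftrightarrow> F face_of half_cube \<and> aff_dim F = int k"

definition hc_face :: "(real ^ 'n) set \<Rightarrow> bool" where
  "hc_face F \<longleftrightarrow> (\<exists>k. k \<le> CARD('n) \<and> k_face k F)"

definition admissible :: "(real ^ 'n) set \<Rightarrow> bool" where
  "admissible V \<longleftrightarrow>
     (\<exists>v\<in>Psi_even. V = {v}) \<or>
     (\<exists>v'\<in>Psi_odd. \<exists>S. 2 \<le> card S \<and> card S \<le> CARD('n) \<and> V = K_set v' S) \<or>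
     (\<exists>v\<in>Psi_even. \<exists>S. 3 \<le> card S \<and> card S < CARD('n) \<and> V = L_set v S)"

end

theory Submission
  imports Defs
begin

text \<open>All three parts come from general facts about faces of convex sets; the half cube enters through two
properties. First, it is the convex hull of a finite set of vectors with \<open>\<plusminus>1\<close> entries, and such
vectors lie on a common sphere about the origin, hence in convex position: a set \<open>V\<close> of them can be
recovered from its hull as the set of sign vectors in the hull (\<open>sign_vector_in_convex_hull\<close>).
Second, its dimension is at most the number of coordinates.

For (i), the intersection of two faces is a face, so it is spanned by some set \<open>W\<close> of points of the
spanning set of the half cube. By convex position \<open>W\<close> is contained in both \<open>V\<close> and \<open>V'\<close>, so the
intersection is no larger than the hull of \<open>V \<inter> V'\<close> (\<open>Int_faces_convex_hull\<close>).

For (ii), a face that contains a relative interior point of a convex subset contains that whole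
subset, so two faces that share a relative interior point contain each other.

For (iii), a point on the relative boundary of a convex set lies in a proper face, of smaller
dimension; descending in this way ends in a face that has the point in its relative interior
(\<open>in_rel_interior_of_face\<close>). This face is the half cube itself, a single point, that is, a vertex, or
has a dimension strictly in between.\<close>

text \<open>A face of minimal dimension among those that contain the point works, since a supporting
hyperplane at a relative boundary point would cut out a smaller one.\<close>

lemma in_rel_interior_of_face:
  fixes S :: "'a::euclidean_space set"
  assumes "convex S" "x \<in> S"
  obtains F where "F face_of S" "x \<in> rel_interior F"
proof -
  have "S face_of S \<and> x \<in> S"
    using assms face_of_refl by blast
  then obtain F where F: "F face_of S" "x \<in> F"
    and least: "\<And>G. G face_of S \<Longrightarrow> x \<in> G \<Longrightarrow> nat (aff_dim F + 1) \<le> nat (aff_dim G + 1)"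
    using ex_has_least_nat[where P = "\<lambda>F. F face_of S \<and> x \<in> F" and k = S
        and m = "\<lambda>F. nat (aff_dim F + 1)"] by blast
  have "convex F"
    using F(1) by (rule face_of_imp_convex)
  have "x \<in> rel_interior F"
  proof (rule ccontr)
    assume "x \<notin> rel_interior F"
    then obtain a where a: "\<And>y. y \<in> F \<Longrightarrow> a \<bullet> x \<le> a \<bullet> y"
      "\<And>y. y \<in> rel_interior F \<Longrightarrow> a \<bullet> x < a \<bullet> y"
      using supporting_hyperplane_rel_boundary[OF \<open>convex F\<close> F(2)] by metis
    let ?G = "F \<inter> {y. a \<bullet> y = a \<bullet> x}"
    have "?G face_of F"
      using face_of_Int_supporting_hyperplane_ge[OF \<open>convex F\<close>] a(1) by blast
    have "rel_interior F \<noteq> {}"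
      using F(2) rel_interior_eq_empty[OF \<open>convex F\<close>] by blast
    then have "?G \<noteq> F"
      using a(2) rel_interior_subset by force
    then have "aff_dim ?G < aff_dim F"
      using face_of_aff_dim_lt[OF \<open>convex F\<close> \<open>?G face_of F\<close>] by blast
    moreover have "nat (aff_dim F + 1) \<le> nat (aff_dim ?G + 1)"
      using least face_of_trans[OF \<open>?G face_of F\<close> F(1)] F(2) by blast
    ultimately show False
      using aff_dim_geq[of ?G] by linarith
  qed
  with F(1) show ?thesis
    using that by blast
qed

text \<open>The hypothesis \<open>pos\<close> is convex position of the points of \<open>P\<close>. It forces the spanning set of the
face \<open>convex hull V \<inter> convex hull V'\<close> to consist of points of \<open>V\<close> and of \<open>V'\<close>.\<close>

lemma Int_faces_convex_hull:
  fixes P :: "'a::euclidean_space set"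
  assumes "compact P"
    and pos: "\<And>U p. U \<subseteq> P \<Longrightarrow> p \<in> P \<Longrightarrow> p \<in> convex hull U \<Longrightarrow> p \<in> U"
    and "V \<subseteq> P" "convex hull V face_of convex hull P"
    and "V' \<subseteq> P" "convex hull V' face_of convex hull P"
  shows "convex hull V \<inter> convex hull V' = convex hull (V \<inter> V')"
proof
  have "(convex hull V \<inter> convex hull V') face_of convex hull P"
    using assms by (intro face_of_Int)
  then obtain W where W: "W \<subseteq> P" "convex hull V \<inter> convex hull V' = convex hull W"
    using face_of_convex_hull_subset[OF \<open>compact P\<close>] by metis
  then have "W \<subseteq> convex hull V" "W \<subseteq> convex hull V'"
    using hull_subset[of W convex] by blast+
  then have "W \<subseteq> V \<inter> V'"
    using W(1) pos \<open>V \<subseteq> P\<close> \<open>V' \<subseteq> P\<close> by blast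
  then show "convex hull V \<inter> convex hull V' \<subseteq> convex hull (V \<inter> V')"
    unfolding W(2) by (rule hull_mono)
  show "convex hull (V \<inter> V') \<subseteq> convex hull V \<inter> convex hull V'"
    by (simp add: hull_mono)
qed

lemma finite_Psi: "finite (Psi :: (real ^ 'n::finite) set)"
proof -
  have "Psi \<subseteq> (vec_lambda ` PiE UNIV (\<lambda>_. {1, -1}) :: (real ^ 'n) set)"
  proof
    fix x :: "real ^ 'n"
    assume "x \<in> Psi"
    then have "vec_nth x \<in> PiE UNIV (\<lambda>_. {1, -1})"
      by (auto simp: Psi_def)
    then show "x \<in> vec_lambda ` PiE UNIV (\<lambda>_. {1, -1})"
      by (intro image_eqI[of _ _ "vec_nth x"]) (simp_all add: vec_nth_inverse)
  qed
  then show ?thesis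
    by (rule finite_subset) (simp add: finite_PiE)
qed

lemma inner_self_Psi:
  assumes "v \<in> (Psi :: (real ^ 'n::finite) set)"
  shows "v \<bullet> v = real CARD('n)"
proof -
  have "v $ i * v $ i = 1" for i
    using assms by (auto simp: Psi_def dest: spec[of _ i])
  then show ?thesis
    by (simp add: inner_vec_def)
qed

text \<open>Points on a common sphere are in convex position: the open half-space cut off by the tangent
hyperplane at \<open>p\<close> contains all the other points, hence also their hull, but not \<open>p\<close>.\<close>

lemma sign_vector_in_convex_hull:
  fixes U :: "(real ^ 'n::finite) set"
  assumes "U \<subseteq> Psi" "p \<in> Psi" "p \<in> convex hull U"
  shows "p \<in> U"
proof (rule ccontr)
  assume "p \<notin> U"
  have "p \<bullet> u < p \<bullet> p" if "u \<in> U" for u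
  proof -
    have "u \<bullet> u = p \<bullet> p"
      using that assms(1,2) by (simp add: inner_self_Psi subsetD[of U])
    moreover have "0 < (p - u) \<bullet> (p - u)"
      using that \<open>p \<notin> U\<close> by auto
    ultimately show ?thesis
      by (simp add: inner_diff inner_commute)
  qed
  then have "convex hull U \<subseteq> {u. p \<bullet> u < p \<bullet> p}"
    by (intro hull_minimal) (auto simp: convex_halfspace_lt)
  with assms(3) show False
    by auto
qed

lemma Psi_even_subset_Psi: "Psi_even \<subseteq> Psi"
  by (auto simp: Psi_even_def)

lemma admissible_subset_Psi_even: "admissible V \<Longrightarrow> V \<subseteq> Psi_even"
  by (auto simp: admissible_def K_set_def L_set_def)

lemma hc_face_imp_face_of: "hc_face F \<Longrightarrow> F face_of half_cube"
  by (auto simp: hc_face_def k_face_def)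

lemma convex_half_cube: "convex half_cube"
  by (simp add: half_cube_def)

lemma Int_admissible_faces:
  fixes V V' :: "(real ^ 'n::finite) set"
  assumes "admissible V" "admissible V'" "hc_face (convex hull V)" "hc_face (convex hull V')"
  shows "convex hull V \<inter> convex hull V' = convex hull (V \<inter> V')"
proof (rule Int_faces_convex_hull)
  show "compact (Psi_even :: (real ^ 'n) set)"
    using finite_Psi Psi_even_subset_Psi by (meson finite_imp_compact finite_subset)
  show "p \<in> U" if "U \<subseteq> Psi_even" "p \<in> Psi_even" "p \<in> convex hull U" for U and p :: "real ^ 'n"
    using that sign_vector_in_convex_hull Psi_even_subset_Psi by (metis subset_iff)
  show "V \<subseteq> Psi_even" "V' \<subseteq> Psi_even"
    using assms admissible_subset_Psi_even by blast+
  show "convex hull V face_of convex hull Psi_even" "convex hull V' face_of convex hull Psi_even"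
    using assms hc_face_imp_face_of unfolding half_cube_def by blast+
qed

text \<open>The face with \<open>x\<close> in its relative interior has dimension \<open>0\<close> only if it is \<open>{x}\<close>, and a proper
face has smaller dimension than the half cube, hence smaller than that of the ambient space.\<close>

lemma half_cube_point_cases:
  fixes x :: "real ^ 'n::finite"
  assumes "x \<in> half_cube" "x \<notin> rel_interior half_cube" "\<not> x extreme_point_of half_cube"
  shows "\<exists>!F. \<exists>k. 0 < k \<and> k < CARD('n) \<and> k_face k F \<and> x \<in> rel_interior F"
proof -
  obtain F where F: "F face_of half_cube" "x \<in> rel_interior F"
    using in_rel_interior_of_face[OF convex_half_cube assms(1)] by blast
  have "x \<in> F"
    using F(2) rel_interior_subset by blast
  have "aff_dim F \<noteq> 0"
  proof
    assume "aff_dim F = 0"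
    then have "F = {x}"
      using \<open>x \<in> F\<close> by (auto simp: aff_dim_eq_0)
    with F(1) assms(3) show False
      by (simp add: face_of_singleton)
  qed
  moreover have "aff_dim F \<noteq> -1"
    using \<open>x \<in> F\<close> aff_dim_empty[of F] by blast
  ultimately have "0 < aff_dim F"
    using aff_dim_geq[of F] by linarith
  have "F \<noteq> half_cube"
    using F(2) assms(2) by blast
  then have "aff_dim F < aff_dim (half_cube :: (real ^ 'n) set)"
    using face_of_aff_dim_lt[OF convex_half_cube F(1)] by blast
  also have "\<dots> \<le> int CARD('n)"
    using aff_dim_le_DIM[of "half_cube :: (real ^ 'n) set"] by simp
  finally have "\<exists>k. 0 < k \<and> k < CARD('n) \<and> k_face k F \<and> x \<in> rel_interior F"
    using F \<open>0 < aff_dim F\<close> unfolding k_face_def by (intro exI[of _ "nat (aff_dim F)"]) auto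
  then show ?thesis
    by (rule ex1I) (use F face_of_eq[of _ half_cube F] in \<open>auto simp: k_face_def\<close>)
qed

theorem theorem2p3p8:
  assumes "CARD('n::finite) \<ge> 4"
  shows "(\<forall>V V' :: (real ^ 'n) set.
            admissible V \<and> admissible V' \<and> hc_face (convex hull V) \<and> hc_face (convex hull V') \<longrightarrow>
            convex hull V \<inter> convex hull V' = convex hull (V \<inter> V'))
       \<and> (\<forall>x \<in> (half_cube :: (real ^ 'n) set). \<forall>F F'.
            hc_face F \<and> x \<in> rel_interior F \<and> hc_face F' \<and> x \<in> rel_interior F' \<longrightarrow> F = F')
       \<and> (\<forall>x \<in> (half_cube :: (real ^ 'n) set).
            x \<in> rel_interior half_cube \<or>
            x extreme_point_of half_cube \<or>
            (\<exists>!F. \<exists>k. 0 < k \<and> k < CARD('n) \<and> k_face k F \<and> x \<in> rel_interior F))"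
proof (intro conjI allI ballI impI)
  fix V V' :: "(real ^ 'n) set"
  assume "admissible V \<and> admissible V' \<and> hc_face (convex hull V) \<and> hc_face (convex hull V')"
  then show "convex hull V \<inter> convex hull V' = convex hull (V \<inter> V')"
    by (intro Int_admissible_faces) simp_all
next
  fix x :: "real ^ 'n" and F F'
  assume "hc_face F \<and> x \<in> rel_interior F \<and> hc_face F' \<and> x \<in> rel_interior F'"
  then show "F = F'"
    by (intro face_of_eq[of F half_cube F']) (auto intro: hc_face_imp_face_of)
next
  fix x :: "real ^ 'n"
  assume "x \<in> half_cube"
  then show "x \<in> rel_interior half_cube \<or> x extreme_point_of half_cube \<or>
      (\<exists>!F. \<exists>k. 0 < k \<and> k < CARD('n) \<and> k_face k F \<and> x \<in> rel_interior F)"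
    using half_cube_point_cases by blast
qed

end
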